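(* Let $N, A, B, a_1, a_2, b_1, b_2$ be positive integers with $a_1 < a_2$ and $b_1 < b_2$ such that $$N = A B = (A + a_1)(B - b_1) = (A + a_2)(B - b_2).$$ If $\max(a_2, b_2) \ge 5$, then $$A \le \frac{1}{4} \max(a_2, b_2) \bigl(\max(a_2, b_2) - 1\bigr)^2 \quad\text{and}\quad B \le \frac{1}{4} \max(a_2, b_2) \bigl(\max(a_2, b_2) - 1\bigr)^2 .$$ *)

theory Defs imports Complex_Main begin

end

(* Put d = a2 * b1 - a1 * b2.  Solving the two linear equations for A and B gives
   d * A = a1 * a2 * (b2 - b1) and d * B = b1 * b2 * (a2 - a1), so d > 0, while
   b2 * a1 + a2 * (b2 - b1) = a2 * b2 - d and a2 * b1 + b2 * (a2 - a1) = a2 * b2 + d.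
   AM-GM bounds both products.  This suffices when d > 1.  When d = 1 the two summands
   are forced apart by congruences modulo a2 and b2, which sharpens AM-GM just enough;
   consecutive values of a2 and b2 are solved explicitly. *)

theory Submission imports Defs begin

lemma four_mult_le_square_add: "4 * (x * y) \<le> (x + y)\<^sup>2" for x y :: int
  using zero_le_power2[of "x - y"] by (simp add: power2_eq_square algebra_simps)

lemma mult_square_le_mult_square:
  fixes x y u v :: int
  assumes "0 \<le> x" "x \<le> u" "0 \<le> y" "y \<le> v"
  shows "x * y\<^sup>2 \<le> u * v\<^sup>2"
  using assms by (intro mult_mono power_mono) auto

text \<open>Pins down an unknown when consecutive moduli leave it congruent to 1: its range is too
  short for a second solution.\<close>

lemma eq_one_if_dvd_diff_one:
  fixes x C :: int
  assumes "C dvd x - 1" "1 \<le> x" "x < C"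
  shows "x = 1"
  using assms zdvd_imp_le[of C "x - 1"] by force

text \<open>Applied with \<open>x = a1\<close> and \<open>y = b2 - b1\<close>. The summands
  \<open>b * x\<close> and \<open>a * y\<close> have product \<open>b * d * A\<close> and total
  below \<open>a * b\<close>, so AM-GM yields \<open>4 * d * A \<le> b * a^2\<close>. Only
  \<open>d = 1\<close> with \<open>a = C\<close> and \<open>b\<close> at least \<open>C - 1\<close>
  escapes this bound.\<close>

lemma first_factor_bound:
  fixes a b x y d A C :: int
  assumes pos: "0 < x" "x < a" "0 < y" "y < b" "0 < d" "0 < A"
    and A: "d * A = x * a * y" and sum: "b * x + a * y = a * b - d"
    and C_def: "C = max a b" and C: "5 \<le> C"
  shows "4 * A \<le> C * (C - 1)\<^sup>2"
proof -
  have aC: "a \<le> C" and bC: "b \<le> C" and b0: "0 < b" and a0: "0 < a"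
    using pos C_def by auto
  have "4 * ((b * x) * (a * y)) \<le> (a * b - d)\<^sup>2"
    using four_mult_le_square_add[of "b * x" "a * y"] sum by simp
  also have "\<dots> \<le> (a * b)\<^sup>2"
  proof (rule power_mono)
    have "0 \<le> b * x + a * y" using pos a0 b0 by simp
    then show "0 \<le> a * b - d" using sum by simp
  qed (use pos in simp)
  finally have "4 * b * (d * A) \<le> b * (b * a\<^sup>2)"
    unfolding A by (simp add: power2_eq_square algebra_simps)
  then have le: "4 * (d * A) \<le> b * a\<^sup>2"
    using b0 by (simp add: mult.assoc mult.left_commute[of 4])
  show ?thesis
  proof (cases "d = 1")
    case False
    then have "2 * A \<le> d * A" using pos by (intro mult_right_mono) auto
    moreover have "b * a\<^sup>2 \<le> C * C\<^sup>2"
      using aC bC a0 b0 by (intro mult_square_le_mult_square) auto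
    \<comment> \<open>A factor \<open>d\<close> of at least 2 pays for replacing \<open>C\<close> by
      \<open>C - 1\<close>: the comparison amounts to \<open>(C - 2)^2 \<ge> 2\<close>.\<close>
    moreover have "C * C\<^sup>2 \<le> C * (2 * (C - 1)\<^sup>2)"
    proof (rule mult_left_mono)
      have "3 * 3 \<le> (C - 2) * (C - 2)" using C by (intro mult_mono) auto
      then show "C\<^sup>2 \<le> 2 * (C - 1)\<^sup>2" using C by (simp add: power2_eq_square algebra_simps)
    qed (use C in simp)
    ultimately show ?thesis using le by linarith
  next
    case d: True
    consider "a \<le> C - 1" | "a = C" "b \<le> C - 2" | "a = C" "b = C - 1" | "a = C" "b = C"
      using aC bC by linarith
    then show ?thesis
    proof cases
      case 1
      then have "b * a\<^sup>2 \<le> C * (C - 1)\<^sup>2"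
        using bC a0 b0 by (intro mult_square_le_mult_square) auto
      then show ?thesis using le d by simp
    next
      case 2
      have "b * a\<^sup>2 \<le> (C - 2) * C\<^sup>2"
        unfolding 2(1) using 2(2) by (intro mult_right_mono) auto
      also have "\<dots> \<le> C * (C - 1)\<^sup>2"
        using C by (simp add: power2_eq_square algebra_simps)
      finally show ?thesis using le d by simp
    next
      case 3
      \<comment> \<open>Modulo \<open>a = C\<close> the coefficient \<open>b\<close> is -1, so
        \<open>sum\<close> reads \<open>- x = - 1\<close>.\<close>
      have "x - 1 = C * (x + y - C + 1)"
        using sum unfolding 3 d by (simp add: algebra_simps)
      then have x: "x = 1"
        using eq_one_if_dvd_diff_one[of C x] pos 3 by simp
      then have "C * y = C * (C - 2)"
        using sum unfolding 3 d by (simp add: algebra_simps)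
      then have "y = C - 2" using C by simp
      then have "A = C * (C - 2)" using A x d 3 by simp
      moreover have "4 * (C - 2) \<le> (C - 1)\<^sup>2"
        using zero_le_power2[of "C - 3"] by (simp add: power2_eq_square algebra_simps)
      then have "C * (4 * (C - 2)) \<le> C * (C - 1)\<^sup>2"
        using C by (intro mult_left_mono) auto
      ultimately show ?thesis by (simp only: mult.left_commute)
    next
      case 4
      have "C * (C - x - y) = 1"
        using sum unfolding 4 d by (simp add: algebra_simps)
      then have "C dvd 1" by (metis dvd_triv_left)
      then show ?thesis using C by simp
    qed
  qed
qed

text \<open>Applied with \<open>p = b1\<close> and \<open>q = a2 - a1\<close>. The total now exceeds
  \<open>a * b\<close>, so plain AM-GM is too weak for \<open>d = 1\<close>; the exact identity
  \<open>eq\<close> keeps the square of the difference \<open>a * p - b * q\<close>, which is then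
  bounded from below.\<close>

lemma second_factor_bound:
  fixes a b p q d B C :: int
  assumes pos: "0 < p" "p < b" "0 < q" "q < a" "0 < d" "0 < B"
    and B: "d * B = p * b * q" and sum: "a * p + b * q = a * b + d"
    and C_def: "C = max a b" and C: "5 \<le> C"
  shows "4 * B \<le> C * (C - 1)\<^sup>2"
proof -
  have aC: "a \<le> C" and bC: "b \<le> C" and b2: "2 \<le> b" and a2: "2 \<le> a"
    using pos C_def by auto
  have C_square: "4 * (C - 1) \<le> (C - 1)\<^sup>2"
    unfolding power2_eq_square using C by (intro mult_right_mono) auto
  define P where "P = a * b"
  have eq: "4 * a * (d * B) = (P + d)\<^sup>2 - (a * p - b * q)\<^sup>2"
    unfolding B P_def sum[symmetric] by (simp add: power2_eq_square algebra_simps)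
  show ?thesis
  proof (cases "d = 1")
    case False
    then have d2: "2 \<le> d" using pos by simp
    have "d \<le> P"
    proof -
      have "a * p \<le> a * b" "b * q \<le> b * a" using pos a2 b2 by auto
      then show ?thesis using sum by (simp add: P_def algebra_simps)
    qed
    have "4 \<le> P" unfolding P_def using mult_mono[of 2 a 2 b] a2 b2 by simp
    have "4 * a * (d * B) \<le> (P + d)\<^sup>2" using eq by simp
    \<comment> \<open>On the range from 2 to \<open>P\<close>, the quotient
      \<open>(P + d)^2 / d\<close> is largest at \<open>d = 2\<close>; the two sides differ by
      exactly \<open>(d - 2) * (P^2 - 2 * d)\<close>.\<close>
    moreover have "2 * (P + d)\<^sup>2 \<le> d * (P + 2)\<^sup>2"
    proof -
      have "2 * d \<le> P * P"
        using mult_mono[of 2 P d P] \<open>d \<le> P\<close> \<open>4 \<le> P\<close> d2 by simp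
      then have "0 \<le> (d - 2) * (P * P - 2 * d)" using d2 by simp
      then show ?thesis by (simp add: power2_eq_square algebra_simps)
    qed
    ultimately have "d * (8 * a * B) \<le> d * (P + 2)\<^sup>2" by (simp add: algebra_simps)
    then have "8 * a * B \<le> (P + 2)\<^sup>2" using pos by simp
    also have "\<dots> \<le> a * (C * C\<^sup>2 + 4 * C + 2)"
    proof -
      have "a * b\<^sup>2 \<le> C * C\<^sup>2"
        using aC bC a2 b2 by (intro mult_square_le_mult_square) auto
      then have "a * (a * b\<^sup>2 + 4 * b + 2) \<le> a * (C * C\<^sup>2 + 4 * C + 2)"
        using bC a2 by (intro mult_left_mono) auto
      then show ?thesis using a2 by (simp add: P_def power2_eq_square algebra_simps)
    qed
    finally have "a * (8 * B) \<le> a * (C * C\<^sup>2 + 4 * C + 2)" by (simp add: algebra_simps)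
    then have "8 * B \<le> C * C\<^sup>2 + 4 * C + 2" using a2 by simp
    also have "\<dots> \<le> 2 * (C * (C - 1)\<^sup>2)"
    proof -
      \<comment> \<open>Twice the target exceeds the left side by this product minus 2. The product
        is negative at \<open>C = 4\<close>, so \<open>C \<ge> 5\<close> matters here.\<close>
      have "5 * 3 \<le> C * (C * (C - 4) - 2)"
        using C mult_mono[of 5 C 1 "C - 4"] by (intro mult_mono) auto
      then show ?thesis by (simp add: power2_eq_square algebra_simps)
    qed
    finally show ?thesis by simp
  next
    case d: True
    \<comment> \<open>Twice the deviations of \<open>p\<close> and \<open>q\<close> from the
      balanced values \<open>b / 2\<close> and \<open>a / 2\<close>. By \<open>e\<close>, the AM-GM
      difference is -1 modulo \<open>a\<close> and 1 modulo \<open>b\<close>, and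
      \<open>a * u + b * v = 2\<close>.\<close>
    define u where "u = 2 * p - b"
    define v where "v = 2 * q - a"
    have e: "a * p - b * q = a * u - 1" "a * p - b * q = 1 - b * v"
      using sum d unfolding u_def v_def by (simp_all add: algebra_simps)
    \<comment> \<open>A vanishing deviation forces \<open>b\<close> or \<open>a\<close> to divide 2.
      Otherwise the difference has absolute value at least \<open>C - 1\<close>, which suffices once
      the smaller of \<open>a\<close> and \<open>b\<close> is at most \<open>C - 2\<close>.\<close>
    consider "u = 0" | "v = 0" | "a = b + 1" | "b = a + 1" | "a = b"
      | "u \<noteq> 0" "v \<noteq> 0" "a = C" "b \<le> C - 2"
      | "u \<noteq> 0" "v \<noteq> 0" "b = C" "a \<le> C - 2"
      using C_def by linarith
    then show ?thesis
    proof cases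
      case 1
      then have "b * v = 2" using e by simp
      then have "b dvd 2" by (metis dvd_triv_left)
      then have b: "b = 2" using b2 zdvd_imp_le[of b 2] by simp
      then have "p = 1" using pos by simp
      then have "4 * B \<le> 8 * q" using B b d by simp
      also have "\<dots> \<le> C * 8" using pos aC by simp
      also have "\<dots> \<le> C * (C - 1)\<^sup>2"
        using C power_mono[of 4 "C - 1" 2] by (intro mult_left_mono) auto
      finally show ?thesis .
    next
      case 2
      then have "a * u = 2" using e by simp
      then have "a dvd 2" by (metis dvd_triv_left)
      then have a: "a = 2" using a2 zdvd_imp_le[of a 2] by simp
      then have "q = 1" using pos by simp
      then have "2 * p = b + 1" using sum d a by simp
      moreover have "4 * B = b * (2 * (2 * p))" using B \<open>q = 1\<close> d by simp
      ultimately have "4 * B = b * (2 * (b + 1))" by simp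
      also have "\<dots> \<le> C * (C - 1)\<^sup>2"
      proof (rule mult_mono)
        have "2 * (b + 1) \<le> 4 * (C - 1)" using bC C by simp
        then show "2 * (b + 1) \<le> (C - 1)\<^sup>2" using C_square by simp
      qed (use bC b2 C in auto)
      finally show ?thesis .
    next
      case 3
      then have "C = a" using C_def by simp
      \<comment> \<open>Reduction of \<open>sum\<close> modulo \<open>b\<close>, where
        \<open>a\<close> is 1.\<close>
      have "p - 1 = b * (b + 1 - p - q)"
        using sum unfolding 3 d by (simp add: algebra_simps)
      then have p: "p = 1"
        using eq_one_if_dvd_diff_one[of b p] pos by simp
      then have "b * q = b * b"
        using sum unfolding 3 d by (simp add: algebra_simps)
      then have "4 * B = 4 * (C - 1)\<^sup>2"
        using B d p b2 3 \<open>C = a\<close> by (simp add: power2_eq_square)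
      also have "\<dots> \<le> C * (C - 1)\<^sup>2" using C by (intro mult_right_mono) auto
      finally show ?thesis .
    next
      case 4
      then have "C = b" using C_def by simp
      have "q - 1 = a * (a + 1 - p - q)"
        using sum unfolding 4 d by (simp add: algebra_simps)
      then have q: "q = 1"
        using eq_one_if_dvd_diff_one[of a q] pos by simp
      then have "a * p = a * a"
        using sum unfolding 4 d by (simp add: algebra_simps)
      then have "4 * B = C * (4 * (C - 1))"
        using B d q a2 4 \<open>C = b\<close> by (simp add: algebra_simps)
      also have "\<dots> \<le> C * (C - 1)\<^sup>2"
        using C C_square by (intro mult_left_mono) auto
      finally show ?thesis .
    next
      case 5
      have "b * (p + q - b) = 1"
        using sum unfolding 5 d by (simp add: algebra_simps)
      then have "b dvd 1" by (metis dvd_triv_left)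
      then show ?thesis using b2 by simp
    next
      case 6
      have "1 * a \<le> \<bar>u\<bar> * a" using 6 a2 by (intro mult_right_mono) auto
      also have "\<dots> = \<bar>a * u\<bar>" using a2 by (simp add: abs_mult)
      finally have "\<bar>C - 1\<bar> \<le> \<bar>a * u - 1\<bar>" using 6 C by linarith
      then have "(C - 1)\<^sup>2 \<le> (a * u - 1)\<^sup>2" by (simp only: abs_le_square_iff)
      then have "4 * a * B \<le> (P + 1)\<^sup>2 - (C - 1)\<^sup>2"
        using eq unfolding e d by simp
      \<comment> \<open>A difference of squares: the factors are \<open>P + C\<close> and
        \<open>P - C + 2\<close>, and \<open>a = C\<close> divides the first.\<close>
      also have "\<dots> = a * ((b + 1) * (C * (b - 1) + 2))"
        using 6 by (simp add: P_def power2_eq_square algebra_simps)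
      finally have "a * (4 * B) \<le> a * ((b + 1) * (C * (b - 1) + 2))"
        by (simp add: algebra_simps)
      then have "4 * B \<le> (b + 1) * (C * (b - 1) + 2)" using a2 by simp
      also have "\<dots> \<le> (C - 1) * (C * (C - 3) + 2)"
        using 6 b2 C by (intro mult_mono add_mono mult_left_mono) auto
      also have "\<dots> = (C - 2) * (C - 1)\<^sup>2" by (simp add: power2_eq_square algebra_simps)
      also have "\<dots> \<le> C * (C - 1)\<^sup>2" by (intro mult_right_mono) auto
      finally show ?thesis .
    next
      case 7
      have "1 * b \<le> \<bar>v\<bar> * b" using 7 b2 by (intro mult_right_mono) auto
      also have "\<dots> = \<bar>b * v\<bar>" using b2 by (simp add: abs_mult)
      finally have "\<bar>C - 1\<bar> \<le> \<bar>1 - b * v\<bar>" using 7 C by linarith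
      then have "(C - 1)\<^sup>2 \<le> (1 - b * v)\<^sup>2" by (simp only: abs_le_square_iff)
      then have "4 * a * B \<le> (P + 1)\<^sup>2 - (C - 1)\<^sup>2"
        using eq unfolding e(2) d by simp
      \<comment> \<open>Here \<open>C = b\<close>, but the factor to cancel is \<open>a\<close>. The
        expression is therefore written as the target minus a product that is nonnegative because
        \<open>a \<le> C - 2\<close>.\<close>
      also have "\<dots> = C * (a * (C - 1)\<^sup>2 - (C - 2 - a) * (C * a + 1))"
        using 7 by (simp add: P_def power2_eq_square algebra_simps)
      also have "\<dots> \<le> C * (a * (C - 1)\<^sup>2)"
        using 7 a2 C by (intro mult_left_mono) auto
      finally have "a * (4 * B) \<le> a * (C * (C - 1)\<^sup>2)" by (simp add: algebra_simps)
      then show ?thesis using a2 by simp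
    qed
  qed
qed

theorem theorem2:
  fixes N A B a1 a2 b1 b2 :: int
  assumes "N > 0" and "A > 0" and "B > 0"
    and "a1 > 0" and "a2 > 0" and "b1 > 0" and "b2 > 0"
    and "a1 < a2" and "b1 < b2"
    and "N = A * B"
    and "A * B = (A + a1) * (B - b1)"
    and "(A + a1) * (B - b1) = (A + a2) * (B - b2)"
    and "max a2 b2 \<ge> 5"
  shows "real_of_int A \<le> 1 / 4 * real_of_int (max a2 b2) * (real_of_int (max a2 b2) - 1)\<^sup>2
    \<and> real_of_int B \<le> 1 / 4 * real_of_int (max a2 b2) * (real_of_int (max a2 b2) - 1)\<^sup>2"
proof -
  define d where "d = a2 * b1 - a1 * b2"
  define C where "C = max a2 b2"
  \<comment> \<open>Expanding each factorization cancels \<open>A * B\<close>, leaving equations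
    linear in \<open>A\<close> and \<open>B\<close>.\<close>
  have e1: "a1 * B - b1 * A = a1 * b1" and e2: "a2 * B - b2 * A = a2 * b2"
    using assms(11,12) by (simp_all add: algebra_simps)
  have dA: "d * A = a1 * a2 * (b2 - b1)"
    using arg_cong[OF e1, of "\<lambda>t. a2 * t"] arg_cong[OF e2, of "\<lambda>t. a1 * t"]
    unfolding d_def by (simp add: algebra_simps)
  have dB: "d * B = b1 * b2 * (a2 - a1)"
    using arg_cong[OF e1, of "\<lambda>t. b2 * t"] arg_cong[OF e2, of "\<lambda>t. b1 * t"]
    unfolding d_def by (simp add: algebra_simps)
  have "0 < d * A" unfolding dA using assms by simp
  then have "0 < d" using assms(2) by (simp add: zero_less_mult_iff)
  have "4 * A \<le> C * (C - 1)\<^sup>2"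
  proof (rule first_factor_bound)
    show "b2 * a1 + a2 * (b2 - b1) = a2 * b2 - d"
      by (simp add: d_def algebra_simps)
  qed (use assms(1-9,13) \<open>0 < d\<close> dA C_def in simp_all)
  moreover have "4 * B \<le> C * (C - 1)\<^sup>2"
  proof (rule second_factor_bound)
    show "a2 * b1 + b2 * (a2 - a1) = a2 * b2 + d"
      by (simp add: d_def algebra_simps)
  qed (use assms(1-9,13) \<open>0 < d\<close> dB C_def in simp_all)
  ultimately have "real_of_int (4 * A) \<le> real_of_int (C * (C - 1)\<^sup>2)"
    "real_of_int (4 * B) \<le> real_of_int (C * (C - 1)\<^sup>2)"
    by (simp_all only: of_int_le_iff)
  then show ?thesis unfolding C_def[symmetric] by simp
qed

end
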